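(* Let $m\in\mathbb{N}$, $(n_1,\dots,n_m)\in\mathbb{N}^m$, let $E_1,\dots,E_m,F$ be Banach spaces over $\mathbb{K}$, and let $P\colon E_1\times\cdots\times E_m\to F$ be a mapping. Then $P$ is an $(n_1,\dots,n_m)$-homogeneous polynomial if and only if there is an $(n_1+\cdots+n_m)$-linear mapping $T\colon E_1^{n_1}\times\cdots\times E_m^{n_m}\to F$ such that $$P(x_1,\dots,x_m)=T(\underbrace{x_1,\dots,x_1}_{n_1},\underbrace{x_2,\dots,x_2}_{n_2},\dots,\underbrace{x_m,\dots,x_m}_{n_m})$$ for all $x_1\in E_1,\dots,x_m\in E_m$.
   Context: $\mathbb{K}=\mathbb{R}$ or $\mathbb{C}$, and $\mathbb{N}=\{1,2,\dots\}$. A mapping $Q\colon E\to F$ is an $n$-homogeneous polynomial if there is an $n$-linear mapping $A\colon E^n\to F$ with $Q(x)=A(x,\dots,x)$ for all $x\in E$ (continuity is not required). A mapping $P\colon E_1\times\cdots\times E_m\to F$ is an $(n_1,\dots,n_m)$-homogeneous polynomial if, for each $i=1,\dots,m$ and all fixed $x_k\in E_k$ ($k\neq i$), the mapping $P(x_1,\dots,x_{i-1},\cdot,x_{i+1},\dots,x_m)\colon E_i\to F$ is an $n_i$-homogeneous polynomial. $E_i^{n_i}$ denotes the $n_i$-fold Cartesian product of $E_i$, so $T$ is linear in each of its $n_1+\cdots+n_m$ variables. Multilinear mappings here are not assumed continuous. *)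

theory Defs
  imports
    "HOL-Analysis.Abstract_Metric_Spaces"
    "HOL-Algebra.Module"
    "HOL-Algebra.Algebraic_Closure_Type"
begin

text \<open>
  The scalar field \<open>\<K>\<close> is a type \<open>'k\<close> of class \<^class>\<open>real_normed_field\<close>, whose norm is
  multiplicative. By the Gelfand-Mazur theorem such a field is isometrically isomorphic to the
  reals or to the complex numbers, so ranging over this class is ranging over the two cases
  \<open>\<K> = \<real>\<close> and \<open>\<K> = \<complex>\<close>. The term \<^const>\<open>ring_of_type_algebra\<close> is this field as a record.

  A normed space is a module record together with a norm. As everywhere in HOL-Algebra, modules
  inherit the fields \<open>mult\<close> and \<open>one\<close> from rings; they play no role here. Spaces with
  explicit carriers are used so that a family of \<open>m\<close> unrelated spaces, with \<open>m\<close> variable, can be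
  quantified over.
\<close>

record ('k, 'a) normed_module = "('k, 'a) module" +
  vnorm :: "'a \<Rightarrow> real"

locale normed_space =
  Module.module "ring_of_type_algebra :: 'k ring" V
  for V :: "('k::real_normed_field, 'a) normed_module" (structure) +
  assumes vnorm_nonneg: "x \<in> carrier V \<Longrightarrow> 0 \<le> vnorm V x"
    and vnorm_eq_zero: "x \<in> carrier V \<Longrightarrow> vnorm V x = 0 \<longleftrightarrow> x = \<zero>\<^bsub>V\<^esub>"
    and vnorm_smult: "x \<in> carrier V \<Longrightarrow> vnorm V (c \<odot>\<^bsub>V\<^esub> x) = norm c * vnorm V x"
    and vnorm_triangle:
      "x \<in> carrier V \<Longrightarrow> y \<in> carrier V \<Longrightarrow> vnorm V (x \<oplus>\<^bsub>V\<^esub> y) \<le> vnorm V x + vnorm V y"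
begin

text \<open>
  The locale \<^locale>\<open>Metric_space\<close> requires symmetry and nonnegativity also outside of the carrier,
  hence the case distinction.
\<close>

definition vdist :: "'a \<Rightarrow> 'a \<Rightarrow> real" where
  "vdist x y = (if x \<in> carrier V \<and> y \<in> carrier V then vnorm V (x \<ominus>\<^bsub>V\<^esub> y) else 0)"

lemma vnorm_uminus:
  assumes x: "x \<in> carrier V"
  shows "vnorm V (\<ominus>\<^bsub>V\<^esub> x) = vnorm V x"
proof -
  have carr: "carrier (ring_of_type_algebra :: 'k ring) = UNIV"
    and one: "\<one>\<^bsub>ring_of_type_algebra\<^esub> = (1 :: 'k)"
    and zero: "\<zero>\<^bsub>ring_of_type_algebra\<^esub> = (0 :: 'k)"
    and add: "\<And>a b :: 'k. a \<oplus>\<^bsub>ring_of_type_algebra\<^esub> b = a + b"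
    by (simp_all add: ring_of_type_algebra_def)
  have c: "(- 1 :: 'k) \<odot>\<^bsub>V\<^esub> x \<in> carrier V"
    using x carr smult_closed by blast
  have "((- 1 :: 'k) \<oplus>\<^bsub>ring_of_type_algebra\<^esub> 1) \<odot>\<^bsub>V\<^esub> x = (- 1) \<odot>\<^bsub>V\<^esub> x \<oplus>\<^bsub>V\<^esub> 1 \<odot>\<^bsub>V\<^esub> x"
    using x carr by (intro smult_l_distr) auto
  moreover have "(1 :: 'k) \<odot>\<^bsub>V\<^esub> x = x"
    using smult_one[OF x] one by simp
  moreover have "(0 :: 'k) \<odot>\<^bsub>V\<^esub> x = \<zero>\<^bsub>V\<^esub>"
    using smult_l_null[OF x] zero by simp
  ultimately have "(- 1 :: 'k) \<odot>\<^bsub>V\<^esub> x \<oplus>\<^bsub>V\<^esub> x = \<zero>\<^bsub>V\<^esub>"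
    by (simp add: add)
  then have "\<ominus>\<^bsub>V\<^esub> x = (- 1 :: 'k) \<odot>\<^bsub>V\<^esub> x"
    using M.minus_equality c x by blast
  then show ?thesis
    using vnorm_smult[OF x, of "- 1"] by simp
qed

sublocale Metric_space "carrier V" vdist
proof
  fix x y
  show "0 \<le> vdist x y"
    by (simp add: vdist_def vnorm_nonneg)
  show "vdist x y = vdist y x"
    using vnorm_uminus[of "x \<ominus>\<^bsub>V\<^esub> y"]
    by (auto simp: vdist_def a_minus_def M.minus_add M.a_comm)
next
  fix x y assume "x \<in> carrier V" "y \<in> carrier V"
  moreover from this have "x \<ominus>\<^bsub>V\<^esub> y = \<zero>\<^bsub>V\<^esub> \<longleftrightarrow> x = y"
    by (metis M.a_inv_closed M.minus_equality M.minus_minus M.r_neg a_minus_def)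
  ultimately show "vdist x y = 0 \<longleftrightarrow> x = y"
    by (simp add: vdist_def vnorm_eq_zero)
next
  fix x y z assume xyz: "x \<in> carrier V" "y \<in> carrier V" "z \<in> carrier V"
  then have "x \<ominus>\<^bsub>V\<^esub> z = (x \<ominus>\<^bsub>V\<^esub> y) \<oplus>\<^bsub>V\<^esub> (y \<ominus>\<^bsub>V\<^esub> z)"
    by (simp add: a_minus_def M.a_assoc M.r_neg1)
  then show "vdist x z \<le> vdist x y + vdist y z"
    using xyz vnorm_triangle[of "x \<ominus>\<^bsub>V\<^esub> y" "y \<ominus>\<^bsub>V\<^esub> z"] by (simp add: vdist_def)
qed

end

locale banach_space = normed_space +
  assumes complete: mcomplete

definition linear_map ::
    "('k, 'a) normed_module \<Rightarrow> ('k, 'b) normed_module \<Rightarrow> ('a \<Rightarrow> 'b) \<Rightarrow> bool" where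
  "linear_map V W f \<longleftrightarrow>
     f \<in> carrier V \<rightarrow> carrier W \<and>
     (\<forall>x\<in>carrier V. \<forall>y\<in>carrier V. f (x \<oplus>\<^bsub>V\<^esub> y) = f x \<oplus>\<^bsub>W\<^esub> f y) \<and>
     (\<forall>c. \<forall>x\<in>carrier V. f (c \<odot>\<^bsub>V\<^esub> x) = c \<odot>\<^bsub>W\<^esub> f x)"

text \<open>
  The product of the carriers of a family of spaces \<open>E k\<close>, \<open>k \<in> I\<close>; its elements are the
  families indexed by \<open>I\<close>, i.e. functions that are \<^const>\<open>undefined\<close> outside of \<open>I\<close>.
\<close>

abbreviation product :: "'i set \<Rightarrow> ('i \<Rightarrow> ('k, 'a) normed_module) \<Rightarrow> ('i \<Rightarrow> 'a) set" where
  "product I E \<equiv> \<Pi>\<^sub>E k\<in>I. carrier (E k)"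

text \<open>Linear in each of the \<^term>\<open>card I\<close> variables; no continuity.\<close>

definition multilinear ::
    "'i set \<Rightarrow> ('i \<Rightarrow> ('k, 'a) normed_module) \<Rightarrow> ('k, 'b) normed_module \<Rightarrow>
     (('i \<Rightarrow> 'a) \<Rightarrow> 'b) \<Rightarrow> bool" where
  "multilinear I E F A \<longleftrightarrow>
     A \<in> product I E \<rightarrow> carrier F \<and>
     (\<forall>k\<in>I. \<forall>x\<in>product I E. linear_map (E k) F (\<lambda>u. A (x(k := u))))"

definition homogeneous_polynomial ::
    "nat \<Rightarrow> ('k, 'a) normed_module \<Rightarrow> ('k, 'b) normed_module \<Rightarrow> ('a \<Rightarrow> 'b) \<Rightarrow> bool" where
  "homogeneous_polynomial n E F Q \<longleftrightarrow>
     Q \<in> carrier E \<rightarrow> carrier F \<and>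
     (\<exists>A. multilinear {1..n} (\<lambda>_. E) F A \<and>
          (\<forall>x\<in>carrier E. Q x = A (\<lambda>j\<in>{1..n}. x)))"

text \<open>
  For each \<open>i\<close>, the components \<open>x k\<close> with \<open>k \<noteq> i\<close> are fixed and the \<open>i\<close>-th one is overwritten by
  the variable.
\<close>

definition multi_homogeneous_polynomial ::
    "nat \<Rightarrow> (nat \<Rightarrow> nat) \<Rightarrow> (nat \<Rightarrow> ('k, 'a) normed_module) \<Rightarrow> ('k, 'b) normed_module \<Rightarrow>
     ((nat \<Rightarrow> 'a) \<Rightarrow> 'b) \<Rightarrow> bool" where
  "multi_homogeneous_polynomial m n E F P \<longleftrightarrow>
     P \<in> product {1..m} E \<rightarrow> carrier F \<and>
     (\<forall>i\<in>{1..m}. \<forall>x\<in>product {1..m} E.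
        homogeneous_polynomial (n i) (E i) F (\<lambda>u. P (x(i := u))))"

text \<open>
  The index set of the \<open>n 1 + \<dots> + n m\<close> variables of a mapping on
  \<open>E 1 ^ n 1 \<times> \<dots> \<times> E m ^ n m\<close>: the pair \<open>(i, j)\<close> stands for the \<open>j\<close>-th variable ranging over \<open>E i\<close>.
\<close>

abbreviation blocks :: "nat \<Rightarrow> (nat \<Rightarrow> nat) \<Rightarrow> (nat \<times> nat) set" where
  "blocks m n \<equiv> (SIGMA i:{1..m}. {1..n i})"

end

theory Submission
  imports Defs
begin

text \<open>
  For the nontrivial direction, all blocks are polarized at once: the value of \<open>T\<close> at \<open>y\<close> is a
  weighted sum, over all choices of subsets \<open>S i \<subseteq> {1..n i}\<close>, of the values of \<open>P\<close> at the points
  with components \<open>\<Sum>j\<in>S i. y (i, j)\<close>. The weight is the product over \<open>i\<close> of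
  \<open>(- 1) ^ (n i - card (S i)) / fact (n i)\<close>. With the subsets of the other blocks fixed, the sum over
  \<open>S i\<close> is the classical polarization of an \<open>n i\<close>-homogeneous polynomial, hence linear in each
  variable of block \<open>i\<close>. On the diagonal, homogeneity of \<open>P\<close> turns the sum into the product over
  \<open>i\<close> of \<open>\<Sum>S. (- 1) ^ (n i - card S) / fact (n i) * card S ^ n i\<close> times \<open>P x\<close>, and each factor is \<open>1\<close>
  because \<open>{1..n i}\<close> has \<open>fact (n i)\<close> self-surjections.
\<close>

section \<open>Finite sums in commutative monoids\<close>

context abelian_monoid
begin

lemma finsum_cartesian:
  assumes "finite A" "finite B" and "\<And>a b. a \<in> A \<Longrightarrow> b \<in> B \<Longrightarrow> g a b \<in> carrier G"
  shows "(\<Oplus>a\<in>A. \<Oplus>b\<in>B. g a b) = (\<Oplus>p\<in>A \<times> B. g (fst p) (snd p))"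
  using assms(1,3)
proof (induction A rule: finite_induct)
  case empty
  then show ?case by simp
next
  case (insert a A)
  have "(\<Oplus>p\<in>insert a A \<times> B. g (fst p) (snd p)) =
      (\<Oplus>p\<in>Pair a ` B \<union> A \<times> B. g (fst p) (snd p))"
    by (rule arg_cong[where f = "finsum _ _"]) auto
  also have "\<dots> = (\<Oplus>p\<in>Pair a ` B. g (fst p) (snd p)) \<oplus> (\<Oplus>p\<in>A \<times> B. g (fst p) (snd p))"
    using insert assms(2) by (intro finsum_Un_disjoint) auto
  also have "(\<Oplus>p\<in>Pair a ` B. g (fst p) (snd p)) = (\<Oplus>b\<in>B. g a b)"
    using insert by (subst finsum_reindex) (auto simp: inj_on_def)
  also have "(\<Oplus>b\<in>B. g a b) \<oplus> (\<Oplus>p\<in>A \<times> B. g (fst p) (snd p)) =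
      (\<Oplus>a\<in>insert a A. \<Oplus>b\<in>B. g a b)"
    using insert by (subst finsum_insert) (auto intro!: finsum_closed)
  finally show ?case ..
qed

lemma finsum_swap:
  assumes "finite A" "finite B" and "\<And>a b. a \<in> A \<Longrightarrow> b \<in> B \<Longrightarrow> g a b \<in> carrier G"
  shows "(\<Oplus>a\<in>A. \<Oplus>b\<in>B. g a b) = (\<Oplus>b\<in>B. \<Oplus>a\<in>A. g a b)"
  using assms(1,3)
proof (induction A rule: finite_induct)
  case empty
  then show ?case by simp
next
  case (insert a A)
  have "(\<Oplus>b\<in>B. \<Oplus>a\<in>insert a A. g a b) = (\<Oplus>b\<in>B. g a b \<oplus> (\<Oplus>a\<in>A. g a b))"
    using insert by (intro finsum_cong') (auto intro!: finsum_closed)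
  also have "\<dots> = (\<Oplus>b\<in>B. g a b) \<oplus> (\<Oplus>b\<in>B. \<Oplus>a\<in>A. g a b)"
    using insert by (intro finsum_addf) (auto intro!: finsum_closed)
  finally show ?case
    using insert by (subst finsum_insert) (auto intro!: finsum_closed)
qed

text \<open>A function on \<open>insert a S\<close> corresponds bijectively to the pair of its value
  at \<open>a\<close> and its restriction to \<open>S\<close>. The coordinate \<open>a\<close> gets
  the inner sum, so that it can be evaluated with the other coordinates held fixed.\<close>

lemma finsum_PiE_insert:
  assumes "finite S" "a \<notin> S" "finite (R a)" and "\<And>s. s \<in> S \<Longrightarrow> finite (R s)"
    and g: "\<And>f. f \<in> Pi\<^sub>E (insert a S) R \<Longrightarrow> g f \<in> carrier G"
  shows "(\<Oplus>f\<in>Pi\<^sub>E (insert a S) R. g f) = (\<Oplus>f\<in>Pi\<^sub>E S R. \<Oplus>r\<in>R a. g (f(a := r)))"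
proof -
  have "(\<Oplus>f\<in>Pi\<^sub>E (insert a S) R. g f) = (\<Oplus>p\<in>R a \<times> Pi\<^sub>E S R. g ((snd p)(a := fst p)))"
    using g inj_combinator[OF assms(2)] unfolding PiE_insert_eq
    by (subst finsum_reindex) (auto simp: case_prod_unfold)
  also have "\<dots> = (\<Oplus>r\<in>R a. \<Oplus>f\<in>Pi\<^sub>E S R. g (f(a := r)))"
    using assms by (subst finsum_cartesian) (auto intro!: finite_PiE g PiE_fun_upd)
  also have "\<dots> = (\<Oplus>f\<in>Pi\<^sub>E S R. \<Oplus>r\<in>R a. g (f(a := r)))"
    using assms by (intro finsum_swap) (auto intro!: finite_PiE g PiE_fun_upd)
  finally show ?thesis .
qed

end

section \<open>Scalar arithmetic in modules over a field\<close>

text \<open>The purely algebraic setting of the argument. The module laws are restated with the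
  operations of the type \<open>'k\<close> in place of those of the record
  \<open>ring_of_type_algebra\<close>, so that ordinary field arithmetic applies to scalars.\<close>

locale field_module = Module.module "ring_of_type_algebra :: 'k ring" V
  for V :: "('k::field, 'a) normed_module" (structure)
begin

lemma smult_in_carrier [simp, intro]: "x \<in> carrier V \<Longrightarrow> (c :: 'k) \<odot> x \<in> carrier V"
  by (rule smult_closed) (auto simp: ring_of_type_algebra_def)

lemma smult_add_right:
  "x \<in> carrier V \<Longrightarrow> y \<in> carrier V \<Longrightarrow> (c :: 'k) \<odot> (x \<oplus> y) = c \<odot> x \<oplus> c \<odot> y"
  by (rule smult_r_distr) (auto simp: ring_of_type_algebra_def)

lemma smult_add_left: "x \<in> carrier V \<Longrightarrow> (a + b :: 'k) \<odot> x = a \<odot> x \<oplus> b \<odot> x"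
  using smult_l_distr[of a b x] by (auto simp: ring_of_type_algebra_def)

lemma smult_mult: "x \<in> carrier V \<Longrightarrow> (a * b :: 'k) \<odot> x = a \<odot> (b \<odot> x)"
  using smult_assoc1[of a b x] by (auto simp: ring_of_type_algebra_def)

lemma smult_1 [simp]: "x \<in> carrier V \<Longrightarrow> (1 :: 'k) \<odot> x = x"
  using smult_one[of x] by (auto simp: ring_of_type_algebra_def)

lemma smult_0_left [simp]: "x \<in> carrier V \<Longrightarrow> (0 :: 'k) \<odot> x = \<zero>"
  using smult_l_null[of x] by (auto simp: ring_of_type_algebra_def)

lemma smult_0_right [simp]: "(c :: 'k) \<odot> \<zero> = \<zero>"
  by (rule smult_r_null) (auto simp: ring_of_type_algebra_def)

lemma smult_left_commute: "x \<in> carrier V \<Longrightarrow> (a :: 'k) \<odot> (b \<odot> x) = b \<odot> (a \<odot> x)"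
  by (simp add: mult.commute flip: smult_mult)

lemma smult_finsum:
  "finite I \<Longrightarrow> f \<in> I \<rightarrow> carrier V \<Longrightarrow> (c :: 'k) \<odot> (\<Oplus>i\<in>I. f i) = (\<Oplus>i\<in>I. c \<odot> f i)"
  by (rule finsum_smult_ldistr) (auto simp: ring_of_type_algebra_def)

lemma sum_smult:
  assumes "finite I" "x \<in> carrier V"
  shows "(\<Sum>i\<in>I. f i :: 'k) \<odot> x = (\<Oplus>i\<in>I. f i \<odot> x)"
  using assms by (induction I rule: finite_induct) (auto simp: smult_add_left M.finsum_insert)

lemma finsum_const_smult:
  "finite I \<Longrightarrow> x \<in> carrier V \<Longrightarrow> (\<Oplus>i\<in>I. x) = (of_nat (card I) :: 'k) \<odot> x"
  using sum_smult[of I x "\<lambda>_. 1"] by (auto cong: M.finsum_cong)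

end

section \<open>Linear, multilinear and separately homogeneous maps\<close>

lemma linear_map_cong:
  assumes "field_module V" and "\<And>x. x \<in> carrier V \<Longrightarrow> f x = g x"
  shows "linear_map V W f \<longleftrightarrow> linear_map V W g"
proof -
  interpret V: field_module V by fact
  show ?thesis
    using assms(2) unfolding linear_map_def by (auto simp: Pi_iff)
qed

lemma linear_map_smult:
  assumes "field_module W" "linear_map V W f"
  shows "linear_map V W (\<lambda>u. c \<odot>\<^bsub>W\<^esub> f u)"
proof -
  interpret W: field_module W by fact
  show ?thesis
    using assms(2) unfolding linear_map_def
    by (auto simp: Pi_iff W.smult_add_right W.smult_left_commute)
qed

lemma linear_map_finsum:
  assumes "field_module W" "finite I" and "\<And>i. i \<in> I \<Longrightarrow> linear_map V W (f i)"
  shows "linear_map V W (\<lambda>u. \<Oplus>\<^bsub>W\<^esub>i\<in>I. f i u)"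
proof -
  interpret W: field_module W by fact
  have f: "\<And>i x. i \<in> I \<Longrightarrow> x \<in> carrier V \<Longrightarrow> f i x \<in> carrier W"
    and add: "\<And>i x y. i \<in> I \<Longrightarrow> x \<in> carrier V \<Longrightarrow> y \<in> carrier V \<Longrightarrow>
      f i (x \<oplus>\<^bsub>V\<^esub> y) = f i x \<oplus>\<^bsub>W\<^esub> f i y"
    and smult: "\<And>i c x. i \<in> I \<Longrightarrow> x \<in> carrier V \<Longrightarrow> f i (c \<odot>\<^bsub>V\<^esub> x) = c \<odot>\<^bsub>W\<^esub> f i x"
    using assms(3) unfolding linear_map_def by blast+
  show ?thesis
    unfolding linear_map_def
  proof (intro conjI ballI allI Pi_I)
    fix x y assume xy: "x \<in> carrier V" "y \<in> carrier V"
    then have "(\<Oplus>\<^bsub>W\<^esub>i\<in>I. f i (x \<oplus>\<^bsub>V\<^esub> y)) = (\<Oplus>\<^bsub>W\<^esub>i\<in>I. f i x \<oplus>\<^bsub>W\<^esub> f i y)"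
      using f by (intro W.finsum_cong') (auto simp: add)
    then show "(\<Oplus>\<^bsub>W\<^esub>i\<in>I. f i (x \<oplus>\<^bsub>V\<^esub> y)) = (\<Oplus>\<^bsub>W\<^esub>i\<in>I. f i x) \<oplus>\<^bsub>W\<^esub> (\<Oplus>\<^bsub>W\<^esub>i\<in>I. f i y)"
      using f xy by (simp add: Pi_iff)
  next
    fix c x assume "x \<in> carrier V"
    then show "(\<Oplus>\<^bsub>W\<^esub>i\<in>I. f i (c \<odot>\<^bsub>V\<^esub> x)) = c \<odot>\<^bsub>W\<^esub> (\<Oplus>\<^bsub>W\<^esub>i\<in>I. f i x)"
      using f assms(2) by (subst W.smult_finsum) (auto simp: smult intro!: W.finsum_cong')
  qed (use f in \<open>auto intro!: W.finsum_closed\<close>)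
qed

lemma linear_map_apply_finsum:
  assumes "field_module V" "field_module W" "linear_map V W f" "finite I" "x \<in> I \<rightarrow> carrier V"
  shows "f (\<Oplus>\<^bsub>V\<^esub>i\<in>I. x i) = (\<Oplus>\<^bsub>W\<^esub>i\<in>I. f (x i))"
proof -
  interpret V: field_module V by fact
  interpret W: field_module W by fact
  have f: "\<And>x. x \<in> carrier V \<Longrightarrow> f x \<in> carrier W"
    and add: "\<And>x y. x \<in> carrier V \<Longrightarrow> y \<in> carrier V \<Longrightarrow> f (x \<oplus>\<^bsub>V\<^esub> y) = f x \<oplus>\<^bsub>W\<^esub> f y"
    and smult: "\<And>c x. x \<in> carrier V \<Longrightarrow> f (c \<odot>\<^bsub>V\<^esub> x) = c \<odot>\<^bsub>W\<^esub> f x"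
    using assms(3) unfolding linear_map_def by blast+
  \<comment> \<open>Homogeneity with the scalar 0; this is the base case of the induction.\<close>
  have "f \<zero>\<^bsub>V\<^esub> = \<zero>\<^bsub>W\<^esub>"
    using smult[of "\<zero>\<^bsub>V\<^esub>" 0] f[of "\<zero>\<^bsub>V\<^esub>"] by simp
  with assms(4,5) show ?thesis
    by (induction I rule: finite_induct)
      (auto simp: V.finsum_insert W.finsum_insert add f V.finsum_closed Pi_iff)
qed

text \<open>The vector \<open>y\<close> only makes the induction on \<open>J\<close> possible.\<close>

lemma multilinear_expand_on:
  assumes F: "field_module F" and E: "\<And>k. k \<in> I \<Longrightarrow> field_module (E k)"
    and A: "multilinear I E F A" and "finite J" "J \<subseteq> I"
    and R: "\<And>k. k \<in> I \<Longrightarrow> finite (R k)"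
    and x: "\<And>k r. k \<in> I \<Longrightarrow> r \<in> R k \<Longrightarrow> x k r \<in> carrier (E k)"
    and y: "\<And>k. k \<in> I \<Longrightarrow> y k \<in> carrier (E k)"
  shows "A (\<lambda>k\<in>I. if k \<in> J then \<Oplus>\<^bsub>E k\<^esub>r\<in>R k. x k r else y k) =
    (\<Oplus>\<^bsub>F\<^esub>f\<in>Pi\<^sub>E J R. A (\<lambda>k\<in>I. if k \<in> J then x k (f k) else y k))"
  using \<open>finite J\<close> \<open>J \<subseteq> I\<close> y
proof (induction J arbitrary: y rule: finite_induct)
  interpret F: field_module F by fact
  have A_closed: "\<And>z. z \<in> product I E \<Longrightarrow> A z \<in> carrier F"
    using A by (auto simp: multilinear_def)
  case empty
  then have "A (\<lambda>k\<in>I. y k) \<in> carrier F"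
    by (intro A_closed) auto
  \<comment> \<open>There is exactly one function in \<open>Pi\<^sub>E {} R\<close>, so the sum has
    a single term.\<close>
  moreover have "(\<Oplus>\<^bsub>F\<^esub>f\<in>Pi\<^sub>E {} R. b) = b" if "b \<in> carrier F" for b
    using that by (simp add: F.finsum_insert)
  ultimately show ?case
    by (simp only: empty_iff if_False)
next
  interpret F: field_module F by fact
  have A_closed: "\<And>z. z \<in> product I E \<Longrightarrow> A z \<in> carrier F"
    using A by (auto simp: multilinear_def)
  case (insert a J)
  then have a: "a \<in> I" and J: "J \<subseteq> I" by auto
  have sum_closed: "(\<Oplus>\<^bsub>E k\<^esub>r\<in>R k. x k r) \<in> carrier (E k)" if "k \<in> I" for k
  proof -
    interpret field_module "E k" using E that .
    show ?thesis using x that by (auto intro!: M.finsum_closed)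
  qed
  \<comment> \<open>The coordinates in \<open>J\<close> already hold their sums, and coordinate
    \<open>a\<close> is about to be overwritten. Linearity in that one coordinate pulls out the sum
    over \<open>R a\<close>.\<close>
  define z where "z = (\<lambda>k\<in>I. if k \<in> J then \<Oplus>\<^bsub>E k\<^esub>r\<in>R k. x k r else y k)"
  have z: "z \<in> product I E"
    using sum_closed insert.prems(2) by (auto simp: z_def)
  have closed: "(\<lambda>k\<in>I. if k \<in> insert a J then x k (f k) else y k) \<in> product I E"
    if "f \<in> Pi\<^sub>E (insert a J) R" for f
    using that a J insert.prems(2) by (auto simp: PiE_iff intro!: x)
  have "A (\<lambda>k\<in>I. if k \<in> insert a J then \<Oplus>\<^bsub>E k\<^esub>r\<in>R k. x k r else y k) =
      A (z(a := \<Oplus>\<^bsub>E a\<^esub>r\<in>R a. x a r))"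
    using a by (intro arg_cong[where f = A]) (auto simp: z_def)
  also have "\<dots> = (\<Oplus>\<^bsub>F\<^esub>r\<in>R a. A (z(a := x a r)))"
  proof (intro linear_map_apply_finsum E F R a)
    show "linear_map (E a) F (\<lambda>u. A (z(a := u)))"
      using A a z unfolding multilinear_def by blast
  qed (use x a in auto)
  also have "\<dots> = (\<Oplus>\<^bsub>F\<^esub>r\<in>R a. \<Oplus>\<^bsub>F\<^esub>f\<in>Pi\<^sub>E J R.
      A (\<lambda>k\<in>I. if k \<in> insert a J then x k ((f(a := r)) k) else y k))"
  proof (intro F.finsum_cong' refl Pi_I F.finsum_closed A_closed closed PiE_fun_upd)
    fix r assume r: "r \<in> R a"
    \<comment> \<open>The chosen vector \<open>x a r\<close> is absorbed into the fixed vector, so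
      that the induction hypothesis applies with \<open>y(a := x a r)\<close> in place of
      \<open>y\<close>.\<close>
    have "A (z(a := x a r)) =
        A (\<lambda>k\<in>I. if k \<in> J then \<Oplus>\<^bsub>E k\<^esub>r\<in>R k. x k r else (y(a := x a r)) k)"
      using a \<open>a \<notin> J\<close> by (intro arg_cong[where f = A]) (auto simp: z_def)
    also have "\<dots> = (\<Oplus>\<^bsub>F\<^esub>f\<in>Pi\<^sub>E J R.
        A (\<lambda>k\<in>I. if k \<in> J then x k (f k) else (y(a := x a r)) k))"
      using insert.prems x a r by (intro insert.IH) auto
    also have "(\<lambda>f. A (\<lambda>k\<in>I. if k \<in> J then x k (f k) else (y(a := x a r)) k)) =
        (\<lambda>f. A (\<lambda>k\<in>I. if k \<in> insert a J then x k ((f(a := r)) k) else y k))"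
      using a \<open>a \<notin> J\<close> by (intro ext arg_cong[where f = A]) auto
    finally show "A (z(a := x a r)) = (\<Oplus>\<^bsub>F\<^esub>f\<in>Pi\<^sub>E J R.
      A (\<lambda>k\<in>I. if k \<in> insert a J then x k ((f(a := r)) k) else y k))" .
  qed auto
  also have "\<dots> = (\<Oplus>\<^bsub>F\<^esub>f\<in>Pi\<^sub>E J R. \<Oplus>\<^bsub>F\<^esub>r\<in>R a.
      A (\<lambda>k\<in>I. if k \<in> insert a J then x k ((f(a := r)) k) else y k))"
    using insert.hyps insert.prems R J a
    by (intro F.finsum_swap A_closed closed PiE_fun_upd finite_PiE) auto
  also have "\<dots> = (\<Oplus>\<^bsub>F\<^esub>f\<in>Pi\<^sub>E (insert a J) R.
      A (\<lambda>k\<in>I. if k \<in> insert a J then x k (f k) else y k))"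
    using insert.hyps insert.prems R J a
    by (intro F.finsum_PiE_insert[symmetric] A_closed closed) auto
  finally show ?case .
qed

lemma multilinear_expand:
  assumes "field_module F" and "\<And>k. k \<in> I \<Longrightarrow> field_module (E k)"
    and "multilinear I E F A" "finite I" and "\<And>k. k \<in> I \<Longrightarrow> finite (R k)"
    and x: "\<And>k r. k \<in> I \<Longrightarrow> r \<in> R k \<Longrightarrow> x k r \<in> carrier (E k)"
  shows "A (\<lambda>k\<in>I. \<Oplus>\<^bsub>E k\<^esub>r\<in>R k. x k r) = (\<Oplus>\<^bsub>F\<^esub>f\<in>Pi\<^sub>E I R. A (\<lambda>k\<in>I. x k (f k)))"
proof -
  \<comment> \<open>For \<open>J = I\<close> the fixed vector never shows up in the values, but its
    components have to lie in the carriers; zero vectors serve as filler.\<close>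
  have "\<zero>\<^bsub>E k\<^esub> \<in> carrier (E k)" if "k \<in> I" for k
  proof -
    interpret field_module "E k" using assms(2) that .
    show ?thesis by simp
  qed
  then have "A (\<lambda>k\<in>I. if k \<in> I then \<Oplus>\<^bsub>E k\<^esub>r\<in>R k. x k r else \<zero>\<^bsub>E k\<^esub>) =
      (\<Oplus>\<^bsub>F\<^esub>f\<in>Pi\<^sub>E I R. A (\<lambda>k\<in>I. if k \<in> I then x k (f k) else \<zero>\<^bsub>E k\<^esub>))"
    using assms by (intro multilinear_expand_on) auto
  then show ?thesis
    by (simp cong: restrict_cong)
qed

text \<open>The coordinates are scaled one after another, and coordinate \<open>k\<close>
  contributes the factor \<open>c k ^ d k\<close>. The lemma serves both multilinear maps, with all
  degrees 1, and the multi-homogeneous \<open>P\<close>, with degrees \<open>n i\<close>.\<close>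

lemma separately_homogeneous_scale:
  fixes E :: "'i \<Rightarrow> ('k::field, 'a) normed_module"
  assumes F: "field_module F" and E: "\<And>k. k \<in> I \<Longrightarrow> field_module (E k)" and "finite I"
    and G: "G \<in> product I E \<rightarrow> carrier F"
    and hom: "\<And>k c z. k \<in> I \<Longrightarrow> z \<in> product I E \<Longrightarrow>
      G (z(k := c \<odot>\<^bsub>E k\<^esub> z k)) = c ^ d k \<odot>\<^bsub>F\<^esub> G z"
    and x: "x \<in> product I E"
  shows "G (\<lambda>k\<in>I. c k \<odot>\<^bsub>E k\<^esub> x k) = (\<Prod>k\<in>I. c k ^ d k) \<odot>\<^bsub>F\<^esub> G x"
proof -
  interpret F: field_module F by fact
  have Gx: "G x \<in> carrier F"
    using G x by auto
  have smult_closed: "c k \<odot>\<^bsub>E k\<^esub> x k \<in> carrier (E k)" if "k \<in> I" for k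
  proof -
    interpret field_module "E k" using E that .
    show ?thesis using x that by auto
  qed
  have "G (\<lambda>k\<in>I. if k \<in> J then c k \<odot>\<^bsub>E k\<^esub> x k else x k) = (\<Prod>k\<in>J. c k ^ d k) \<odot>\<^bsub>F\<^esub> G x"
    if "finite J" "J \<subseteq> I" for J
    using that
  proof (induction J rule: finite_induct)
    case empty
    have "(\<lambda>k\<in>I. x k) = x"
      using x by (auto simp: fun_eq_iff PiE_def extensional_def)
    then show ?case
      using Gx by simp
  next
    case (insert a J)
    define z where "z = (\<lambda>k\<in>I. if k \<in> J then c k \<odot>\<^bsub>E k\<^esub> x k else x k)"
    have z: "z \<in> product I E"
      using smult_closed x by (auto simp: z_def)
    \<comment> \<open>Since \<open>a\<close> is not in \<open>J\<close>, \<open>z a\<close> is still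
      the unscaled \<open>x a\<close>.\<close>
    have "(\<lambda>k\<in>I. if k \<in> insert a J then c k \<odot>\<^bsub>E k\<^esub> x k else x k) = z(a := c a \<odot>\<^bsub>E a\<^esub> z a)"
      using insert by (auto simp: z_def)
    then have "G (\<lambda>k\<in>I. if k \<in> insert a J then c k \<odot>\<^bsub>E k\<^esub> x k else x k) =
        c a ^ d a \<odot>\<^bsub>F\<^esub> G z"
      using insert.prems hom[OF _ z, of a "c a"] by (simp only:) blast
    also have "G z = (\<Prod>k\<in>J. c k ^ d k) \<odot>\<^bsub>F\<^esub> G x"
      using insert unfolding z_def by blast
    finally show ?case
      using insert.hyps Gx by (simp add: F.smult_mult)
  qed
  from this[of I] show ?thesis
    using \<open>finite I\<close> by (simp cong: restrict_cong)
qed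

section \<open>Combinatorial identities for the polarization weights\<close>

text \<open>The exponent is \<open>n + card S\<close> instead of \<open>n - card S\<close> to avoid truncated subtraction.\<close>

abbreviation polar_weight :: "nat \<Rightarrow> nat set \<Rightarrow> 'k::{field,ring_char_0}" where
  "polar_weight n S \<equiv> (- 1) ^ (n + card S) / fact n"

text \<open>If \<open>K\<close> is a proper subset, as many of its supersets in
  \<open>{1..n}\<close> have even as odd cardinality, and the signs cancel. If \<open>K\<close> is
  everything, only \<open>S = {1..n}\<close> is left, with the even exponent \<open>n + n\<close>.
  The condition is a conditional summand rather than a restricted range, so that sums over
  \<open>S\<close> and over functions can be interchanged.\<close>

lemma sum_polar_weight_superset:
  assumes "K \<subseteq> {1..n}"
  shows "(\<Sum>S\<in>Pow {1..n}. if K \<subseteq> S then polar_weight n S else 0) =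
    (if K = {1..n} then 1 / fact n else (0 :: 'k::{field,ring_char_0}))"
proof -
  have "(\<Sum>S\<in>Pow {1..n}. if K \<subseteq> S then polar_weight n S else 0) =
      (\<Sum>S | S \<subseteq> {1..n} \<and> K \<subseteq> S. polar_weight n S :: 'k)"
    by (intro sum.mono_neutral_cong_right) auto
  also have "\<dots> = (- 1) ^ n / fact n * (\<Sum>S | S \<subseteq> {1..n} \<and> K \<subseteq> S. (- 1) ^ card S)"
    by (simp add: sum_distrib_left power_add)
  also have "\<dots> = (if K = {1..n} then 1 / fact n else 0)"
  proof (cases "K = {1..n}")
    case True
    then have "{S. S \<subseteq> {1..n} \<and> K \<subseteq> S} = {{1..n}}" by auto
    moreover have "(- 1) ^ n * (- 1) ^ n = (1 :: 'k)"
      by (simp flip: power_mult_distrib)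
    ultimately show ?thesis
      using True by simp
  next
    case False
    then show ?thesis
      using assms card_subsupersets_even_odd[of "{1..n}" K]
      by (subst sum_alternating_cancels) (auto simp: conj_assoc)
  qed
  finally show ?thesis .
qed

lemma image_eq_iff_bij_betw:
  assumes "finite N" "f \<in> N \<rightarrow> N"
  shows "f ` N = N \<longleftrightarrow> bij_betw f N N"
  using assms eq_card_imp_inj_on[of N f] unfolding bij_betw_def by metis

lemma card_inj_endofunctions:
  "card {f \<in> {1..n} \<rightarrow>\<^sub>E {1..n::nat}. inj_on f {1..n}} = fact n"
proof -
  have "card {f \<in> {1..n} \<rightarrow>\<^sub>E {1..n::nat}. inj_on f {1..n}} =
      card {1..n} ^ (card {1..n} - card {1..n}) * prod ((-) (card {1..n})) {0..<card {1..n}}"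
    by (rule card_inj_on_subset_funcset) (rule finite_atLeastAtMost order_refl)+
  then show ?thesis
    unfolding fact_prod_rev of_nat_id card_atLeastAtMost diff_Suc_1 diff_self_eq_0 power_0 mult_1 .
qed

text \<open>The power \<open>card S ^ n\<close> counts the maps from \<open>{1..n}\<close> to
  \<open>S\<close>. After interchanging the sums, a self-map \<open>f\<close> collects the weights
  of all \<open>S\<close> containing its image; this is \<open>1 / fact n\<close> if
  \<open>f\<close> is surjective and 0 otherwise. Surjective self-maps of a finite set are
  injective, and there are \<open>fact n\<close> of them.\<close>

lemma sum_polar_weight_power:
  "(\<Sum>S\<in>Pow {1..n}. polar_weight n S * of_nat (card S) ^ n) = (1 :: 'k::{field,ring_char_0})"
proof -
  let ?N = "{1..n}" and ?M = "{1..n} \<rightarrow>\<^sub>E {1..n}"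
  have fin: "finite ?M"
    by (intro finite_PiE) auto
  have "(\<Sum>S\<in>Pow ?N. polar_weight n S * of_nat (card S) ^ n) =
      (\<Sum>S\<in>Pow ?N. \<Sum>f\<in>?M. if f ` ?N \<subseteq> S then polar_weight n S else (0 :: 'k))"
  proof (intro sum.cong refl)
    fix S assume "S \<in> Pow ?N"
    then have "f \<in> ?M \<and> f ` ?N \<subseteq> S \<longleftrightarrow> f \<in> ?N \<rightarrow>\<^sub>E S" for f
      unfolding PiE_iff image_subset_iff by blast
    then have "{f \<in> ?M. f ` ?N \<subseteq> S} = ?N \<rightarrow>\<^sub>E S"
      by blast
    then have "card {f \<in> ?M. f ` ?N \<subseteq> S} = card S ^ n"
      by (simp only: card_funcsetE finite_atLeastAtMost) simp
    then show "polar_weight n S * of_nat (card S) ^ n =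
        (\<Sum>f\<in>?M. if f ` ?N \<subseteq> S then polar_weight n S else (0 :: 'k))"
      by (simp only: sum.inter_filter[OF fin, symmetric] sum_constant of_nat_power)
        (simp only: mult.commute)
  qed
  also have "\<dots> = (\<Sum>f\<in>?M. \<Sum>S\<in>Pow ?N. if f ` ?N \<subseteq> S then polar_weight n S else 0)"
    by (rule sum.swap)
  also have "\<dots> = (\<Sum>f\<in>?M. if f ` ?N = ?N then 1 / fact n else 0)"
    by (intro sum.cong refl sum_polar_weight_superset) auto
  also have "\<dots> = of_nat (card {f \<in> ?M. f ` ?N = ?N}) / fact n"
    by (simp only: sum.inter_filter[OF fin, symmetric] sum_constant) simp
  also have "{f \<in> ?M. f ` ?N = ?N} = {f \<in> ?M. inj_on f ?N}"
  proof (intro Collect_cong conj_cong refl)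
    fix f assume "f \<in> ?M"
    then have "f ` ?N \<subseteq> ?N" by auto
    then show "f ` ?N = ?N \<longleftrightarrow> inj_on f ?N"
      using endo_inj_surj[of ?N f] eq_card_imp_inj_on[of ?N f] by fastforce
  qed
  also have "card \<dots> = fact n"
    by (rule card_inj_endofunctions)
  finally show ?thesis by simp
qed

section \<open>Homogeneous polynomials on one space: scaling and polarization\<close>

lemma homogeneous_polynomial_scale:
  fixes E :: "('k::field, 'a) normed_module"
  assumes "field_module E" "field_module F" and Q: "homogeneous_polynomial n E F Q"
    and x: "x \<in> carrier E"
  shows "Q (c \<odot>\<^bsub>E\<^esub> x) = c ^ n \<odot>\<^bsub>F\<^esub> Q x"
proof -
  interpret E: field_module E by fact
  obtain A where A: "multilinear {1..n} (\<lambda>_. E) F A"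
    and Q_eq: "\<And>x. x \<in> carrier E \<Longrightarrow> Q x = A (\<lambda>j\<in>{1..n}. x)"
    using Q by (auto simp: homogeneous_polynomial_def)
  \<comment> \<open>All \<open>n\<close> variables are scaled by the same \<open>c\<close>, each
    with degree 1, so the product of the factors is \<open>c ^ n\<close>.\<close>
  have "A (\<lambda>j\<in>{1..n}. c \<odot>\<^bsub>E\<^esub> (\<lambda>j\<in>{1..n}. x) j) =
      (\<Prod>j\<in>{1..n}. c ^ 1) \<odot>\<^bsub>F\<^esub> A (\<lambda>j\<in>{1..n}. x)"
  proof (intro separately_homogeneous_scale assms)
    fix k c z assume "k \<in> {1..n}" "z \<in> product {1..n} (\<lambda>_. E)"
    then have "linear_map E F (\<lambda>u. A (z(k := u)))" "z k \<in> carrier E"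
      using A by (auto simp: multilinear_def)
    then show "A (z(k := c \<odot>\<^bsub>E\<^esub> z k)) = c ^ 1 \<odot>\<^bsub>F\<^esub> A z"
      by (auto simp: linear_map_def)
  qed (use A x in \<open>auto simp: multilinear_def\<close>)
  then show ?thesis
    using x by (simp add: Q_eq cong: restrict_cong)
qed

text \<open>After expanding by multilinearity, the weights cancel every term \<open>A (x \<circ> f)\<close> in which \<open>f\<close> is
  not a permutation.\<close>

lemma polarization_expand:
  fixes E :: "('k::{field,ring_char_0}, 'a) normed_module"
  assumes "field_module E" "field_module F" and A: "multilinear {1..n} (\<lambda>_. E) F A"
    and x: "x \<in> {1..n} \<rightarrow> carrier E"
  shows "(\<Oplus>\<^bsub>F\<^esub>S\<in>Pow {1..n}. polar_weight n S \<odot>\<^bsub>F\<^esub> A (\<lambda>i\<in>{1..n}. \<Oplus>\<^bsub>E\<^esub>j\<in>S. x j)) =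
    (\<Oplus>\<^bsub>F\<^esub>f\<in>{f \<in> {1..n} \<rightarrow>\<^sub>E {1..n}. bij_betw f {1..n} {1..n}}.
      (1 / fact n) \<odot>\<^bsub>F\<^esub> A (\<lambda>i\<in>{1..n}. x (f i)))"
proof -
  interpret E: field_module E by fact
  interpret F: field_module F by fact
  let ?N = "{1..n}" and ?M = "{1..n} \<rightarrow>\<^sub>E {1..n}"
  define a where "a f = A (\<lambda>i\<in>?N. x (f i))" for f
  have fin: "finite ?M"
    by (intro finite_PiE) auto
  have a: "a f \<in> carrier F" if "f \<in> ?M" for f
    using A x that by (auto simp: a_def multilinear_def Pi_iff PiE_iff)
  have "(\<Oplus>\<^bsub>F\<^esub>S\<in>Pow ?N. polar_weight n S \<odot>\<^bsub>F\<^esub> A (\<lambda>i\<in>?N. \<Oplus>\<^bsub>E\<^esub>j\<in>S. x j)) =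
      (\<Oplus>\<^bsub>F\<^esub>S\<in>Pow ?N. \<Oplus>\<^bsub>F\<^esub>f\<in>?M. (if f ` ?N \<subseteq> S then polar_weight n S else 0) \<odot>\<^bsub>F\<^esub> a f)"
  proof (intro F.finsum_cong' refl Pi_I F.finsum_closed F.smult_in_carrier a)
    fix S assume "S \<in> Pow ?N"
    then have S: "S \<subseteq> ?N" by simp
    have sub: "?N \<rightarrow>\<^sub>E S \<subseteq> ?M"
      using S by (intro PiE_mono) auto
    \<comment> \<open>Every variable carries the same sum over \<open>S\<close>, so the choice
      functions of the expansion are the maps from \<open>{1..n}\<close> to
      \<open>S\<close>.\<close>
    have "A (\<lambda>i\<in>?N. \<Oplus>\<^bsub>E\<^esub>j\<in>S. x j) = (\<Oplus>\<^bsub>F\<^esub>f\<in>?N \<rightarrow>\<^sub>E S. a f)"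
      unfolding a_def using S x A finite_subset[OF S]
      by (intro multilinear_expand[where E = "\<lambda>_. E" and x = "\<lambda>_. x"] assms) auto
    then have "polar_weight n S \<odot>\<^bsub>F\<^esub> A (\<lambda>i\<in>?N. \<Oplus>\<^bsub>E\<^esub>j\<in>S. x j) =
        (\<Oplus>\<^bsub>F\<^esub>f\<in>?N \<rightarrow>\<^sub>E S. polar_weight n S \<odot>\<^bsub>F\<^esub> a f)"
      using sub a finite_subset[OF sub fin] by (auto intro!: F.smult_finsum)
    \<comment> \<open>Zero terms extend the range to all self-maps of \<open>{1..n}\<close>. The
      range no longer depends on \<open>S\<close>, which makes the interchange of sums below
      possible.\<close>
    also have "\<dots> = (\<Oplus>\<^bsub>F\<^esub>f\<in>?M. (if f ` ?N \<subseteq> S then polar_weight n S else 0) \<odot>\<^bsub>F\<^esub> a f)"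
    proof (intro F.add.finprod_mono_neutral_cong_left fin sub)
      fix f assume "f \<in> ?M - (?N \<rightarrow>\<^sub>E S)"
      then have "\<not> f ` ?N \<subseteq> S" "f \<in> ?M"
        by (auto simp: PiE_iff image_subset_iff)
      then show "(if f ` ?N \<subseteq> S then polar_weight n S else 0) \<odot>\<^bsub>F\<^esub> a f = \<zero>\<^bsub>F\<^esub>"
        using a by simp
    next
      fix f assume "f \<in> ?N \<rightarrow>\<^sub>E S"
      then have "f ` ?N \<subseteq> S" by auto
      then show "polar_weight n S \<odot>\<^bsub>F\<^esub> a f =
          (if f ` ?N \<subseteq> S then polar_weight n S else 0) \<odot>\<^bsub>F\<^esub> a f"
        by simp
    qed (use a in auto)
    finally show "polar_weight n S \<odot>\<^bsub>F\<^esub> A (\<lambda>i\<in>?N. \<Oplus>\<^bsub>E\<^esub>j\<in>S. x j) =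
        (\<Oplus>\<^bsub>F\<^esub>f\<in>?M. (if f ` ?N \<subseteq> S then polar_weight n S else 0) \<odot>\<^bsub>F\<^esub> a f)" .
  qed
  also have "\<dots> =
      (\<Oplus>\<^bsub>F\<^esub>f\<in>?M. \<Oplus>\<^bsub>F\<^esub>S\<in>Pow ?N. (if f ` ?N \<subseteq> S then polar_weight n S else 0) \<odot>\<^bsub>F\<^esub> a f)"
    using a fin by (intro F.finsum_swap) auto
  also have "\<dots> =
      (\<Oplus>\<^bsub>F\<^esub>f\<in>{f \<in> ?M. bij_betw f ?N ?N}. (1 / fact n) \<odot>\<^bsub>F\<^esub> a f)"
  proof (intro F.add.finprod_mono_neutral_cong_right fin)
    \<comment> \<open>For fixed \<open>f\<close> the vector \<open>a f\<close> is common to all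
      terms, and what remains is a sum of scalar weights over the supersets of the image of
      \<open>f\<close>.\<close>
    have collect: "(\<Oplus>\<^bsub>F\<^esub>S\<in>Pow ?N. (if f ` ?N \<subseteq> S then polar_weight n S else 0) \<odot>\<^bsub>F\<^esub> a f) =
        (if bij_betw f ?N ?N then 1 / fact n else 0) \<odot>\<^bsub>F\<^esub> a f" if f: "f \<in> ?M" for f
    proof -
      have "(\<Oplus>\<^bsub>F\<^esub>S\<in>Pow ?N. (if f ` ?N \<subseteq> S then polar_weight n S else 0) \<odot>\<^bsub>F\<^esub> a f) =
          (\<Sum>S\<in>Pow ?N. if f ` ?N \<subseteq> S then polar_weight n S else 0) \<odot>\<^bsub>F\<^esub> a f"
        using a[OF f] by (intro F.sum_smult[symmetric]) auto
      also have "f ` ?N \<subseteq> ?N"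
        using f by auto
      note sum_polar_weight_superset[OF this]
      also have "f ` ?N = ?N \<longleftrightarrow> bij_betw f ?N ?N"
        using f by (intro image_eq_iff_bij_betw) auto
      finally show ?thesis .
    qed
    show "(\<Oplus>\<^bsub>F\<^esub>S\<in>Pow ?N. (if f ` ?N \<subseteq> S then polar_weight n S else 0) \<odot>\<^bsub>F\<^esub> a f) = \<zero>\<^bsub>F\<^esub>"
      if "f \<in> ?M - {f \<in> ?M. bij_betw f ?N ?N}" for f
      using that a by (subst collect) auto
    show "(\<Oplus>\<^bsub>F\<^esub>S\<in>Pow ?N. (if f ` ?N \<subseteq> S then polar_weight n S else 0) \<odot>\<^bsub>F\<^esub> a f) =
        (1 / fact n) \<odot>\<^bsub>F\<^esub> a f"
      if "f \<in> {f \<in> ?M. bij_betw f ?N ?N}" for f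
      using that by (subst collect) auto
  qed (use a in \<open>auto intro!: F.finsum_closed\<close>)
  finally show ?thesis
    unfolding a_def .
qed

text \<open>In the expansion by \<open>polarization_expand\<close> only permutations
  \<open>f\<close> survive. For these, the vector with index \<open>k\<close> is an argument of
  \<open>A\<close> exactly once, so each term is linear in \<open>u\<close>.\<close>

lemma linear_map_polarization:
  fixes E :: "('k::{field,ring_char_0}, 'a) normed_module"
  assumes E: "field_module E" and F: "field_module F" and Q: "homogeneous_polynomial n E F Q"
    and x: "x \<in> {1..n} \<rightarrow> carrier E" and k: "k \<in> {1..n}"
  shows "linear_map E F (\<lambda>u. \<Oplus>\<^bsub>F\<^esub>S\<in>Pow {1..n}.
    polar_weight n S \<odot>\<^bsub>F\<^esub> Q (\<Oplus>\<^bsub>E\<^esub>j\<in>S. (x(k := u)) j))"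
proof -
  interpret E: field_module E by fact
  interpret F: field_module F by fact
  let ?N = "{1..n}"
  obtain A where A: "multilinear ?N (\<lambda>_. E) F A"
    and Q_eq: "\<And>x. x \<in> carrier E \<Longrightarrow> Q x = A (\<lambda>j\<in>?N. x)"
    using Q by (auto simp: homogeneous_polynomial_def)
  have A_closed: "A z \<in> carrier F" if "z \<in> product ?N (\<lambda>_. E)" for z
    using A that by (auto simp: multilinear_def)
  have expand: "(\<Oplus>\<^bsub>F\<^esub>S\<in>Pow ?N. polar_weight n S \<odot>\<^bsub>F\<^esub> Q (\<Oplus>\<^bsub>E\<^esub>j\<in>S. (x(k := u)) j)) =
      (\<Oplus>\<^bsub>F\<^esub>f\<in>{f \<in> ?N \<rightarrow>\<^sub>E ?N. bij_betw f ?N ?N}.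
        (1 / fact n) \<odot>\<^bsub>F\<^esub> A (\<lambda>i\<in>?N. (x(k := u)) (f i)))" if u: "u \<in> carrier E" for u
  proof -
    have xu: "x(k := u) \<in> ?N \<rightarrow> carrier E"
      using x u by auto
    then have sum_closed: "(\<Oplus>\<^bsub>E\<^esub>j\<in>S. (x(k := u)) j) \<in> carrier E" if "S \<subseteq> ?N" for S
      using that by (intro E.finsum_closed) blast
    have "(\<Oplus>\<^bsub>F\<^esub>S\<in>Pow ?N. polar_weight n S \<odot>\<^bsub>F\<^esub> Q (\<Oplus>\<^bsub>E\<^esub>j\<in>S. (x(k := u)) j)) =
        (\<Oplus>\<^bsub>F\<^esub>S\<in>Pow ?N.
          polar_weight n S \<odot>\<^bsub>F\<^esub> A (\<lambda>i\<in>?N. \<Oplus>\<^bsub>E\<^esub>j\<in>S. (x(k := u)) j))"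
      using sum_closed by (intro F.finsum_cong' refl Pi_I F.smult_in_carrier A_closed)
        (auto simp: Q_eq simp del: fun_upd_apply)
    then show ?thesis
      using polarization_expand[OF E F A xu] by simp
  qed
  have "linear_map E F (\<lambda>u. A (\<lambda>i\<in>?N. (x(k := u)) (f i)))"
    if f: "f \<in> ?N \<rightarrow>\<^sub>E ?N" "bij_betw f ?N ?N" for f
  proof -
    \<comment> \<open>Since \<open>f\<close> is a permutation, \<open>k\<close> has exactly one
      preimage \<open>l\<close>, which is the position of \<open>u\<close> among the arguments of
      \<open>A\<close>.\<close>
    have "k \<in> f ` ?N"
      using f(2) k by (simp add: bij_betw_def)
    then obtain l where l: "l \<in> ?N" "f l = k"
      by blast
    have "f i = k \<longleftrightarrow> i = l" if "i \<in> ?N" for i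
      using f(2) l that unfolding bij_betw_def by (metis inj_onD)
    then have "(\<lambda>i\<in>?N. (x(k := u)) (f i)) = (\<lambda>i\<in>?N. x (f i))(l := u)" for u
      using l(1) by (auto simp: fun_eq_iff)
    moreover have "(\<lambda>i\<in>?N. x (f i)) \<in> product ?N (\<lambda>_. E)"
      using f(1) x by auto
    ultimately show ?thesis
      using A l(1) unfolding multilinear_def by simp
  qed
  then have "linear_map E F (\<lambda>u. \<Oplus>\<^bsub>F\<^esub>f\<in>{f \<in> ?N \<rightarrow>\<^sub>E ?N. bij_betw f ?N ?N}.
      (1 / fact n) \<odot>\<^bsub>F\<^esub> A (\<lambda>i\<in>?N. (x(k := u)) (f i)))"
    by (intro linear_map_finsum linear_map_smult F finite_subset[OF _ finite_PiE[of ?N "\<lambda>_. ?N"]])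
      auto
  \<comment> \<open>The expansion is available only for \<open>u\<close> in the carrier, which is
    all that linearity looks at.\<close>
  then show ?thesis
    by (subst linear_map_cong[OF E expand])
qed

section \<open>From a multilinear mapping to a multi-homogeneous polynomial\<close>

lemma multi_homogeneous_if_multilinear:
  assumes P: "P \<in> product {1..m} E \<rightarrow> carrier F"
    and T: "multilinear (blocks m n) (\<lambda>(i, j). E i) F T"
    and P_eq: "\<And>x. x \<in> product {1..m} E \<Longrightarrow> P x = T (\<lambda>(i, j)\<in>blocks m n. x i)"
  shows "multi_homogeneous_polynomial m n E F P"
  unfolding multi_homogeneous_polynomial_def
proof (intro conjI ballI P)
  fix i x assume i: "i \<in> {1..m}" and x: "x \<in> product {1..m} E"
  let ?B = "blocks m n" and ?E = "\<lambda>(i, j). E i"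
  \<comment> \<open>The family \<open>v y\<close> has the entries of \<open>y\<close> in block
    \<open>i\<close> and repeats \<open>x i'\<close> throughout every other block \<open>i'\<close>.
    Hence \<open>T (v y)\<close> is multilinear in \<open>y\<close>, and constant \<open>y\<close>
    recovers \<open>P\<close>.\<close>
  define v where "v y = (\<lambda>(i', j)\<in>?B. if i' = i then y j else x i')" for y
  have v: "v y \<in> product ?B ?E" if "y \<in> product {1..n i} (\<lambda>_. E i)" for y
    using x that by (auto simp: v_def PiE_iff)
  have v_upd: "v (y(k := u)) = (v y)((i, k) := u)" if "k \<in> {1..n i}" for y k u
    using i that by (auto simp: v_def fun_eq_iff)
  have "multilinear {1..n i} (\<lambda>_. E i) F (\<lambda>y. T (v y))"
    unfolding multilinear_def
  proof (intro conjI ballI Pi_I)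
    fix y assume "y \<in> product {1..n i} (\<lambda>_. E i)"
    then show "T (v y) \<in> carrier F"
      using T v unfolding multilinear_def by blast
  next
    fix k y assume k: "k \<in> {1..n i}" and y: "y \<in> product {1..n i} (\<lambda>_. E i)"
    have "linear_map (?E (i, k)) F (\<lambda>u. T ((v y)((i, k) := u)))"
      using T v[OF y] i k unfolding multilinear_def by blast
    then show "linear_map (E i) F (\<lambda>u. T (v (y(k := u))))"
      using k by (simp only: v_upd case_prod_conv)
  qed
  moreover have "P (x(i := u)) = T (v (\<lambda>j\<in>{1..n i}. u))" if "u \<in> carrier (E i)" for u
  proof -
    have "x(i := u) \<in> product {1..m} E"
      using x i that by (auto simp: PiE_iff extensional_def)
    moreover have "(\<lambda>(i', j)\<in>?B. (x(i := u)) i') = v (\<lambda>j\<in>{1..n i}. u)"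
      by (auto simp: v_def fun_eq_iff)
    ultimately show ?thesis
      by (simp only: P_eq)
  qed
  moreover have "(\<lambda>u. P (x(i := u))) \<in> carrier (E i) \<rightarrow> carrier F"
    using P x i by (auto simp: PiE_iff extensional_def Pi_iff)
  ultimately show "homogeneous_polynomial (n i) (E i) F (\<lambda>u. P (x(i := u)))"
    unfolding homogeneous_polynomial_def by blast
qed

section \<open>Simultaneous polarization of all blocks\<close>

definition multi_polarization ::
    "nat \<Rightarrow> (nat \<Rightarrow> nat) \<Rightarrow> (nat \<Rightarrow> ('k::{field,ring_char_0}, 'a) normed_module) \<Rightarrow>
     ('k, 'b) normed_module \<Rightarrow> ((nat \<Rightarrow> 'a) \<Rightarrow> 'b) \<Rightarrow> (nat \<times> nat \<Rightarrow> 'a) \<Rightarrow> 'b" where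
  "multi_polarization m n E F P y =
     (\<Oplus>\<^bsub>F\<^esub>S\<in>(\<Pi>\<^sub>E i\<in>{1..m}. Pow {1..n i}). (\<Prod>i\<in>{1..m}. polar_weight (n i) (S i)) \<odot>\<^bsub>F\<^esub>
        P (\<lambda>i\<in>{1..m}. \<Oplus>\<^bsub>E i\<^esub>j\<in>S i. y (i, j)))"

context
  fixes m n and E :: "nat \<Rightarrow> ('k::{field,ring_char_0}, 'a) normed_module"
    and F :: "('k, 'b) normed_module" and P
  assumes E: "\<And>i. i \<in> {1..m} \<Longrightarrow> field_module (E i)" and F: "field_module F"
    and P: "multi_homogeneous_polynomial m n E F P"
begin

interpretation F: field_module F by (rule F)

lemma multi_homogeneous_closed: "x \<in> product {1..m} E \<Longrightarrow> P x \<in> carrier F"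
  using P by (auto simp: multi_homogeneous_polynomial_def)

lemma block_sum_closed:
  assumes "i \<in> {1..m}" "y \<in> product (blocks m n) (\<lambda>(i, j). E i)" "R \<subseteq> {1..n i}"
  shows "(\<Oplus>\<^bsub>E i\<^esub>j\<in>R. y (i, j)) \<in> carrier (E i)"
proof -
  interpret field_module "E i" using E assms(1) .
  show ?thesis
    using assms by (intro M.finsum_closed) (fastforce simp: PiE_iff)
qed

text \<open>The subset chosen for block \<open>i\<close> is separated from the others. With the
  others fixed, the inner sum is the one-variable polarization of \<open>P\<close> in component
  \<open>i\<close>, linear by \<open>linear_map_polarization\<close>; the outer sum is a linear
  combination of such maps.\<close>

lemma linear_map_multi_polarization:
  assumes i: "i \<in> {1..m}" and k: "k \<in> {1..n i}"
    and y: "y \<in> product (blocks m n) (\<lambda>(i, j). E i)"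
  shows "linear_map (E i) F (\<lambda>u. multi_polarization m n E F P (y((i, k) := u)))"
proof -
  interpret Ei: field_module "E i" using E i .
  let ?I = "{1..m}"
  let ?J = "?I - {i}"
  let ?R = "\<lambda>i. Pow {1..n i}"
  \<comment> \<open>Component \<open>i\<close> of \<open>z S\<close> is always overwritten; it is \<open>\<zero>\<close> only to keep \<open>z S\<close> in the product.\<close>
  define z where "z S = (\<lambda>i'\<in>?I. if i' = i then \<zero>\<^bsub>E i\<^esub> else \<Oplus>\<^bsub>E i'\<^esub>j\<in>S i'. y (i', j))" for S
  have z: "z S \<in> product ?I E" if "S \<in> Pi\<^sub>E ?J ?R" for S
    using that block_sum_closed[OF _ y] by (auto simp: z_def PiE_iff)
  have I: "?I = insert i ?J"
    using i by auto
  have split: "multi_polarization m n E F P (y((i, k) := u)) =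
      (\<Oplus>\<^bsub>F\<^esub>S\<in>Pi\<^sub>E ?J ?R. (\<Prod>i\<in>?J. polar_weight (n i) (S i)) \<odot>\<^bsub>F\<^esub>
        (\<Oplus>\<^bsub>F\<^esub>R\<in>?R i. polar_weight (n i) R \<odot>\<^bsub>F\<^esub>
          P ((z S)(i := \<Oplus>\<^bsub>E i\<^esub>j\<in>R. ((\<lambda>j. y (i, j))(k := u)) j))))"
    if u: "u \<in> carrier (E i)" for u
  proof -
    let ?y = "y((i, k) := u)"
    have y': "?y \<in> product (blocks m n) (\<lambda>(i, j). E i)"
      using y u i k by (auto simp: PiE_iff extensional_def)
    \<comment> \<open>The summand as a function of the whole family \<open>S\<close>, the form in
      which \<open>finsum_PiE_insert\<close> splits off \<open>S i\<close>.\<close>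
    define g where "g S = (\<Prod>i\<in>?I. polar_weight (n i) (S i)) \<odot>\<^bsub>F\<^esub>
        P (\<lambda>i\<in>?I. \<Oplus>\<^bsub>E i\<^esub>j\<in>S i. ?y (i, j))" for S
    have g: "g S \<in> carrier F" if "S \<in> Pi\<^sub>E ?I ?R" for S
      unfolding g_def using that block_sum_closed[OF _ y']
      by (intro F.smult_in_carrier multi_homogeneous_closed) (auto simp: PiE_iff simp del: fun_upd_apply)
    have "multi_polarization m n E F P ?y = (\<Oplus>\<^bsub>F\<^esub>S\<in>Pi\<^sub>E (insert i ?J) ?R. g S)"
      unfolding multi_polarization_def g_def I[symmetric] ..
    also have "\<dots> = (\<Oplus>\<^bsub>F\<^esub>S\<in>Pi\<^sub>E ?J ?R. \<Oplus>\<^bsub>F\<^esub>R\<in>?R i. g (S(i := R)))"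
    proof (intro F.finsum_PiE_insert)
      show "g S \<in> carrier F" if "S \<in> Pi\<^sub>E (insert i ?J) ?R" for S
        using that by (intro g) (simp only: I[symmetric])
    qed auto
    also have "\<dots> = (\<Oplus>\<^bsub>F\<^esub>S\<in>Pi\<^sub>E ?J ?R. (\<Prod>i\<in>?J. polar_weight (n i) (S i)) \<odot>\<^bsub>F\<^esub>
        (\<Oplus>\<^bsub>F\<^esub>R\<in>?R i. polar_weight (n i) R \<odot>\<^bsub>F\<^esub>
          P ((z S)(i := \<Oplus>\<^bsub>E i\<^esub>j\<in>R. ((\<lambda>j. y (i, j))(k := u)) j))))"
    proof (rule F.finsum_cong'[OF refl])
      let ?h = "\<lambda>S R. P ((z S)(i := \<Oplus>\<^bsub>E i\<^esub>j\<in>R. ((\<lambda>j. y (i, j))(k := u)) j))"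
      have h: "?h S R \<in> carrier F" if "S \<in> Pi\<^sub>E ?J ?R" "R \<subseteq> {1..n i}" for S R
      proof (intro multi_homogeneous_closed)
        have "(\<Oplus>\<^bsub>E i\<^esub>j\<in>R. ((\<lambda>j. y (i, j))(k := u)) j) \<in> carrier (E i)"
          using block_sum_closed[OF i y' that(2)] by (simp add: fun_upd_def)
        then show "(z S)(i := \<Oplus>\<^bsub>E i\<^esub>j\<in>R. ((\<lambda>j. y (i, j))(k := u)) j) \<in> product ?I E"
          using z[OF that(1)] i by (auto simp: PiE_iff extensional_def)
      qed
      then show "(\<lambda>S. (\<Prod>i\<in>?J. polar_weight (n i) (S i)) \<odot>\<^bsub>F\<^esub>
          (\<Oplus>\<^bsub>F\<^esub>R\<in>?R i. polar_weight (n i) R \<odot>\<^bsub>F\<^esub> ?h S R)) \<in> Pi\<^sub>E ?J ?R \<rightarrow> carrier F"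
        by (intro Pi_I F.smult_in_carrier F.finsum_closed) auto
      fix S assume S: "S \<in> Pi\<^sub>E ?J ?R"
      let ?w = "\<Prod>i\<in>?J. polar_weight (n i) (S i) :: 'k"
      have "(\<Oplus>\<^bsub>F\<^esub>R\<in>?R i. g (S(i := R))) =
          (\<Oplus>\<^bsub>F\<^esub>R\<in>?R i. ?w \<odot>\<^bsub>F\<^esub> (polar_weight (n i) R \<odot>\<^bsub>F\<^esub> ?h S R))"
      proof (intro F.finsum_cong' refl Pi_I F.smult_in_carrier h[OF S])
        fix R assume R: "R \<in> ?R i"
        have "(\<Prod>i'\<in>?I. polar_weight (n i') ((S(i := R)) i')) = polar_weight (n i) R * ?w"
          using i by (subst prod.remove[of _ i]) (auto intro!: prod.cong)
        \<comment> \<open>The changed entry \<open>(i, k)\<close> lies in block \<open>i\<close>, so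
          all other block sums are those of the original \<open>y\<close>.\<close>
        moreover have "(\<lambda>i'\<in>?I. \<Oplus>\<^bsub>E i'\<^esub>j\<in>(S(i := R)) i'. ?y (i', j)) =
            (z S)(i := \<Oplus>\<^bsub>E i\<^esub>j\<in>R. ((\<lambda>j. y (i, j))(k := u)) j)"
          using i by (auto simp: z_def fun_eq_iff fun_upd_def)
        ultimately have "g (S(i := R)) = (polar_weight (n i) R * ?w) \<odot>\<^bsub>F\<^esub> ?h S R"
          unfolding g_def by (simp only:)
        then show "g (S(i := R)) = ?w \<odot>\<^bsub>F\<^esub> (polar_weight (n i) R \<odot>\<^bsub>F\<^esub> ?h S R)"
          using h[OF S] R by (simp only: F.smult_mult[symmetric] mult.commute Pow_iff)
      qed auto
      also have "\<dots> = ?w \<odot>\<^bsub>F\<^esub> (\<Oplus>\<^bsub>F\<^esub>R\<in>?R i. polar_weight (n i) R \<odot>\<^bsub>F\<^esub> ?h S R)"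
        using h[OF S] by (intro F.smult_finsum[symmetric]) auto
      finally show "(\<Oplus>\<^bsub>F\<^esub>R\<in>?R i. g (S(i := R))) =
          ?w \<odot>\<^bsub>F\<^esub> (\<Oplus>\<^bsub>F\<^esub>R\<in>?R i. polar_weight (n i) R \<odot>\<^bsub>F\<^esub> ?h S R)" .
    qed
    finally show ?thesis .
  qed
  have "linear_map (E i) F (\<lambda>u. \<Oplus>\<^bsub>F\<^esub>S\<in>Pi\<^sub>E ?J ?R. (\<Prod>i\<in>?J. polar_weight (n i) (S i)) \<odot>\<^bsub>F\<^esub>
        (\<Oplus>\<^bsub>F\<^esub>R\<in>?R i. polar_weight (n i) R \<odot>\<^bsub>F\<^esub>
          P ((z S)(i := \<Oplus>\<^bsub>E i\<^esub>j\<in>R. ((\<lambda>j. y (i, j))(k := u)) j))))"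
  proof (rule linear_map_finsum[OF F])
    show "finite (Pi\<^sub>E ?J ?R)"
      by (intro finite_PiE) auto
    fix S assume S: "S \<in> Pi\<^sub>E ?J ?R"
    have "homogeneous_polynomial (n i) (E i) F (\<lambda>u. P ((z S)(i := u)))"
      using P i z[OF S] unfolding multi_homogeneous_polynomial_def by blast
    moreover have "(\<lambda>j. y (i, j)) \<in> {1..n i} \<rightarrow> carrier (E i)"
      using y i by (fastforce simp: PiE_iff)
    ultimately show "linear_map (E i) F (\<lambda>u. (\<Prod>i\<in>?J. polar_weight (n i) (S i)) \<odot>\<^bsub>F\<^esub>
        (\<Oplus>\<^bsub>F\<^esub>R\<in>?R i. polar_weight (n i) R \<odot>\<^bsub>F\<^esub>
          P ((z S)(i := \<Oplus>\<^bsub>E i\<^esub>j\<in>R. ((\<lambda>j. y (i, j))(k := u)) j))))"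
      using k by (intro linear_map_smult[OF F] linear_map_polarization[OF Ei.field_module_axioms F])
  qed
  then show ?thesis
    by (subst linear_map_cong[OF Ei.field_module_axioms split])
qed

lemma multilinear_multi_polarization:
  "multilinear (blocks m n) (\<lambda>(i, j). E i) F (multi_polarization m n E F P)"
  unfolding multilinear_def
proof (intro conjI ballI Pi_I)
  fix y assume y: "y \<in> product (blocks m n) (\<lambda>(i, j). E i)"
  show "multi_polarization m n E F P y \<in> carrier F"
    unfolding multi_polarization_def using block_sum_closed[OF _ y]
    by (intro F.finsum_closed Pi_I F.smult_in_carrier multi_homogeneous_closed) (auto simp: PiE_iff)
next
  fix p y assume "p \<in> blocks m n" "y \<in> product (blocks m n) (\<lambda>(i, j). E i)"
  then show "linear_map ((\<lambda>(i, j). E i) p) F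
      (\<lambda>u. multi_polarization m n E F P (y(p := u)))"
    by (cases p) (simp only: case_prod_conv mem_Sigma_iff linear_map_multi_polarization)
qed

lemma multi_homogeneous_scale:
  assumes x: "x \<in> product {1..m} E"
  shows "P (\<lambda>i\<in>{1..m}. c i \<odot>\<^bsub>E i\<^esub> x i) = (\<Prod>i\<in>{1..m}. c i ^ n i) \<odot>\<^bsub>F\<^esub> P x"
proof (intro separately_homogeneous_scale F E x)
  fix i c z assume i: "i \<in> {1..m}" and z: "z \<in> product {1..m} E"
  have "homogeneous_polynomial (n i) (E i) F (\<lambda>u. P (z(i := u)))"
    using P i z unfolding multi_homogeneous_polynomial_def by blast
  moreover have "z i \<in> carrier (E i)"
    using z i by auto
  ultimately have "P (z(i := c \<odot>\<^bsub>E i\<^esub> z i)) = c ^ n i \<odot>\<^bsub>F\<^esub> P (z(i := z i))"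
    using E i F by (intro homogeneous_polynomial_scale)
  then show "P (z(i := c \<odot>\<^bsub>E i\<^esub> z i)) = c ^ n i \<odot>\<^bsub>F\<^esub> P z"
    by simp
qed (use multi_homogeneous_closed in auto)

lemma multi_polarization_diagonal:
  assumes x: "x \<in> product {1..m} E"
  shows "multi_polarization m n E F P (\<lambda>(i, j)\<in>blocks m n. x i) = P x"
proof -
  let ?I = "{1..m}" and ?R = "\<lambda>i. Pow {1..n i}"
  let ?w = "\<lambda>i S. polar_weight (n i) S * of_nat (card S) ^ n i :: 'k"
  have fin: "finite (Pi\<^sub>E ?I ?R)"
    by (intro finite_PiE) auto
  have "multi_polarization m n E F P (\<lambda>(i, j)\<in>blocks m n. x i) =
      (\<Oplus>\<^bsub>F\<^esub>S\<in>Pi\<^sub>E ?I ?R. (\<Prod>i\<in>?I. ?w i (S i)) \<odot>\<^bsub>F\<^esub> P x)"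
    unfolding multi_polarization_def
  proof (intro F.finsum_cong' refl Pi_I F.smult_in_carrier multi_homogeneous_closed x)
    fix S assume S: "S \<in> Pi\<^sub>E ?I ?R"
    have "(\<Oplus>\<^bsub>E i\<^esub>j\<in>S i. (\<lambda>(i, j)\<in>blocks m n. x i) (i, j)) = of_nat (card (S i)) \<odot>\<^bsub>E i\<^esub> x i"
      if i: "i \<in> ?I" for i
    proof -
      interpret Ei: field_module "E i" using E i .
      have Si: "S i \<subseteq> {1..n i}"
        using S i by auto
      have "(\<Oplus>\<^bsub>E i\<^esub>j\<in>S i. (\<lambda>(i, j)\<in>blocks m n. x i) (i, j)) = (\<Oplus>\<^bsub>E i\<^esub>j\<in>S i. x i)"
        using Si i x by (intro Ei.finsum_cong') auto
      also have "\<dots> = of_nat (card (S i)) \<odot>\<^bsub>E i\<^esub> x i"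
        using finite_subset[OF Si] x i by (intro Ei.finsum_const_smult) auto
      finally show ?thesis .
    qed
    \<comment> \<open>Each block sum on the diagonal is a multiple of \<open>x i\<close>;
      \<open>multi_homogeneous_scale\<close> then turns the multiples into the factors
      \<open>of_nat (card (S i)) ^ n i\<close>.\<close>
    then have "P (\<lambda>i\<in>?I. \<Oplus>\<^bsub>E i\<^esub>j\<in>S i. (\<lambda>(i, j)\<in>blocks m n. x i) (i, j)) =
        P (\<lambda>i\<in>?I. of_nat (card (S i)) \<odot>\<^bsub>E i\<^esub> x i)"
      by (intro arg_cong[where f = P] restrict_ext)
    then show "(\<Prod>i\<in>?I. polar_weight (n i) (S i)) \<odot>\<^bsub>F\<^esub>
        P (\<lambda>i\<in>?I. \<Oplus>\<^bsub>E i\<^esub>j\<in>S i. (\<lambda>(i, j)\<in>blocks m n. x i) (i, j)) =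
        (\<Prod>i\<in>?I. ?w i (S i)) \<odot>\<^bsub>F\<^esub> P x"
      using multi_homogeneous_closed[OF x]
      by (simp only: multi_homogeneous_scale[OF x] F.smult_mult[symmetric] prod.distrib)
  qed
  also have "\<dots> = (\<Sum>S\<in>Pi\<^sub>E ?I ?R. \<Prod>i\<in>?I. ?w i (S i)) \<odot>\<^bsub>F\<^esub> P x"
    using fin multi_homogeneous_closed[OF x] by (intro F.sum_smult[symmetric])
  \<comment> \<open>Distributivity: a sum over independent choices of \<open>S i\<close> of a
    product over \<open>i\<close> is the product of the sums for the single blocks.\<close>
  also have "(\<Sum>S\<in>Pi\<^sub>E ?I ?R. \<Prod>i\<in>?I. ?w i (S i)) = (\<Prod>i\<in>?I. \<Sum>S\<in>?R i. ?w i S)"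
    by (intro prod_sum_PiE[symmetric]) auto
  also have "\<dots> = 1"
    by (simp only: sum_polar_weight_power prod.neutral_const)
  finally show ?thesis
    using multi_homogeneous_closed[OF x] by (simp only: F.smult_1)
qed

end

theorem theorem2p2:
  fixes m :: nat and n :: "nat \<Rightarrow> nat"
    and E :: "nat \<Rightarrow> ('k::real_normed_field, 'a) normed_module"
    and F :: "('k, 'b) normed_module"
    and P :: "(nat \<Rightarrow> 'a) \<Rightarrow> 'b"
  assumes "m \<ge> 1" and "\<And>i. i \<in> {1..m} \<Longrightarrow> n i \<ge> 1"
    and "\<And>i. i \<in> {1..m} \<Longrightarrow> banach_space (E i)" and "banach_space F"
    and "P \<in> product {1..m} E \<rightarrow> carrier F"
  shows "multi_homogeneous_polynomial m n E F P \<longleftrightarrow>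
    (\<exists>T. multilinear (blocks m n) (\<lambda>(i, j). E i) F T \<and>
         (\<forall>x\<in>product {1..m} E. P x = T (\<lambda>(i, j)\<in>blocks m n. x i)))"
proof
  \<comment> \<open>Stated for a separate vector type \<open>'c\<close>, so that it applies both to
    the spaces \<open>E i\<close> and to \<open>F\<close>.\<close>
  have field_module: "banach_space V \<Longrightarrow> field_module V" for V :: "('k, 'c) normed_module"
    by (simp add: banach_space_def normed_space_def field_module_def)
  note modules = field_module[OF assms(3)] field_module[OF assms(4)]
  assume "multi_homogeneous_polynomial m n E F P"
  with modules show "\<exists>T. multilinear (blocks m n) (\<lambda>(i, j). E i) F T \<and>
      (\<forall>x\<in>product {1..m} E. P x = T (\<lambda>(i, j)\<in>blocks m n. x i))"
    by (intro exI[of _ "multi_polarization m n E F P"] conjI ballI)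
      (rule multilinear_multi_polarization multi_polarization_diagonal[symmetric]; assumption)+
next
  assume "\<exists>T. multilinear (blocks m n) (\<lambda>(i, j). E i) F T \<and>
      (\<forall>x\<in>product {1..m} E. P x = T (\<lambda>(i, j)\<in>blocks m n. x i))"
  then show "multi_homogeneous_polynomial m n E F P"
    using multi_homogeneous_if_multilinear[OF assms(5)] by blast
qed

end
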